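(* Let $\mathcal{H}=(V,H)\in\mathrm{mGU}(2)$ have more than four vertices. Then there exists some $p\in V$ such that the restriction $(V\setminus\{p\},H\cap 2^{V\setminus\{p\}})$ of $\mathcal{H}$ to $V\setminus\{p\}$ is in $\mathrm{mGU}(2)$.
   Context: A simplicial complex is a pair $(V,H)$ with $V$ finite nonempty, $H\subseteq 2^V$ containing all singletons and closed under subsets; its dimension is $\max\{|X|:X\in H\}-1$. $P_{\le k}(V)$ denotes the set of subsets of $V$ with at most $k$ elements. $\mathrm{Pav}(d)$ is the class of complexes of dimension $d$ with $P_{\le d}(V)\subseteq H$. For $(V,H)\in\mathrm{Pav}(d)$, $T(H)=\{T\subseteq V\mid X\cup\{p\}\in H \text{ for all } X\in H\cap P_{\le d}(V),\ X\subseteq T,\ p\in V\setminus T\}$, and $J(T(H))$ is the set of all sets $\{x_1,\dots,x_k\}$ for which there is a chain $T_0\subset\cdots\subset T_k$ in $T(H)$ with $x_i\in T_i\setminus T_{i-1}$. $(V,H)\in\mathrm{Pav}(d)$ goes up if $\dim(V,J(T(H)))>d$; $\mathrm{GU}(d)$ and $\mathrm{NGU}(d)$ are the classes of complexes in $\mathrm{Pav}(d)$ which go up, resp. do not go up. $\mathrm{mGU}(d)$ is the class of $(V,H)\in\mathrm{GU}(d)$ such that $(V,H')\in\mathrm{NGU}(d)$ whenever $H\supsetneq H'\supsetneq P_{\le d}(V)$. *)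

theory Defs
  imports Main
begin

definition simplicial_complex :: "'a set \<times> 'a set set \<Rightarrow> bool" where
  "simplicial_complex = (\<lambda>(V, H).
     finite V \<and> V \<noteq> {} \<and> H \<subseteq> Pow V \<and> (\<forall>v\<in>V. {v} \<in> H) \<and>
     (\<forall>X\<in>H. \<forall>Y. Y \<subseteq> X \<longrightarrow> Y \<in> H))"

definition sc_dim :: "'a set \<times> 'a set set \<Rightarrow> int" where
  "sc_dim = (\<lambda>(V, H). int (Max (card ` H)) - 1)"

definition subsets_le :: "nat \<Rightarrow> 'a set \<Rightarrow> 'a set set" where
  "subsets_le k V = {X. X \<subseteq> V \<and> card X \<le> k}"

definition Pav :: "nat \<Rightarrow> ('a set \<times> 'a set set) set" where
  "Pav d = {(V, H). simplicial_complex (V, H) \<and> sc_dim (V, H) = int d \<and> subsets_le d V \<subseteq> H}"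

definition TH :: "nat \<Rightarrow> 'a set \<times> 'a set set \<Rightarrow> 'a set set" where
  "TH d = (\<lambda>(V, H). {T. T \<subseteq> V \<and>
     (\<forall>X \<in> H \<inter> subsets_le d V. X \<subseteq> T \<longrightarrow> (\<forall>p \<in> V - T. X \<union> {p} \<in> H))})"

text \<open>The case \<open>k = 0\<close> (a one-element chain) contributes the empty set.\<close>

definition J :: "'a set set \<Rightarrow> 'a set set" where
  "J \<T> = {x ` {1..k} | (x :: nat \<Rightarrow> 'a) (k :: nat). \<exists>T :: nat \<Rightarrow> 'a set.
     (\<forall>i\<le>k. T i \<in> \<T>) \<and>
     (\<forall>i\<in>{1..k}. T (i - 1) \<subset> T i \<and> x i \<in> T i - T (i - 1))}"

definition goes_up :: "nat \<Rightarrow> 'a set \<times> 'a set set \<Rightarrow> bool" where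
  "goes_up d = (\<lambda>(V, H). sc_dim (V, J (TH d (V, H))) > int d)"

definition GU :: "nat \<Rightarrow> ('a set \<times> 'a set set) set" where
  "GU d = {C \<in> Pav d. goes_up d C}"

definition NGU :: "nat \<Rightarrow> ('a set \<times> 'a set set) set" where
  "NGU d = {C \<in> Pav d. \<not> goes_up d C}"

definition mGU :: "nat \<Rightarrow> ('a set \<times> 'a set set) set" where
  "mGU d = {(V, H). (V, H) \<in> GU d \<and>
     (\<forall>H'. subsets_le d V \<subset> H' \<and> H' \<subset> H \<longrightarrow> (V, H') \<in> NGU d)}"

definition sc_restrict :: "'a set \<times> 'a set set \<Rightarrow> 'a set \<Rightarrow> 'a set \<times> 'a set set" where
  "sc_restrict = (\<lambda>(V, H) W. (W, H \<inter> Pow W))"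

end

theory Submission
  imports Defs
begin

text \<open>
  A complex \<open>(V, H)\<close> in \<open>Pav(2)\<close> goes up iff \<open>T(H)\<close> contains sets \<open>A \<subset> B \<subset> V\<close> with \<open>|A| \<ge> 2\<close>.
  The least such \<open>H\<close> for given \<open>A\<close> and \<open>B\<close> adds to \<open>P\<^bsub>\<le>2\<^esub>(V)\<close> the triples meeting \<open>A\<close> or \<open>B\<close> in
  exactly two points, so \<open>mGU(2)\<close> consists of the minimal complexes of this form. For \<open>|V| > 4\<close>
  they are those with \<open>|V \<setminus> B| \<ge> 2\<close> and (\<open>|B \<setminus> A| \<ge> 2\<close> or \<open>|A| = 2\<close>), while for \<open>|V| = 4\<close> every
  complex of this form is minimal. Restriction to \<open>V \<setminus> {p}\<close> replaces \<open>A\<close> and \<open>B\<close> by \<open>A \<setminus> {p}\<close> and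
  \<open>B \<setminus> {p}\<close>, and the numerical condition survives the removal of a suitable \<open>p\<close>.
\<close>

section \<open>Flags and their complexes\<close>

definition flag :: "'a set \<Rightarrow> 'a set \<Rightarrow> 'a set \<Rightarrow> bool" where
  "flag V A B \<longleftrightarrow> finite V \<and> A \<subset> B \<and> B \<subset> V \<and> 2 \<le> card A"

definition flag_complex :: "'a set \<Rightarrow> 'a set \<Rightarrow> 'a set \<Rightarrow> 'a set set" where
  "flag_complex V A B =
    {X. X \<subseteq> V \<and> (card X \<le> 2 \<or> card X = 3 \<and> (card (X \<inter> A) = 2 \<or> card (X \<inter> B) = 2))}"

text \<open>Minimality concerns the complex and not the pair, because different flags can give the
  same complex, as \<open>flag_complex_card_3\<close> shows.\<close>

definition minimal_flag :: "'a set \<Rightarrow> 'a set \<Rightarrow> 'a set \<Rightarrow> bool" where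
  "minimal_flag V A B \<longleftrightarrow> flag V A B \<and>
    (\<forall>A' B'. flag V A' B' \<and> flag_complex V A' B' \<subseteq> flag_complex V A B
      \<longrightarrow> flag_complex V A' B' = flag_complex V A B)"

lemma card_ge_2_obtain:
  assumes "2 \<le> card A"
  obtains x y where "x \<in> A" "y \<in> A" "x \<noteq> y"
  using assms by (metis card_le_Suc_iff insertCI numeral_2_eq_2)

lemma card_ge_3_obtain:
  assumes "3 \<le> card A"
  obtains x y z where "x \<in> A" "y \<in> A" "z \<in> A" "x \<noteq> y" "x \<noteq> z" "y \<noteq> z"
proof -
  obtain B where "B \<subseteq> A" "card B = 3"
    using assms by (meson obtain_subset_with_card_n)
  then show ?thesis
    using that by (auto simp: card_3_iff)
qed

text \<open>Turns the cardinality conditions into membership of the three points, so that explicit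
  triples can be tested by propositional reasoning.\<close>

lemma triple_in_flag_complex:
  assumes "x \<noteq> y" "x \<noteq> z" "y \<noteq> z"
  shows "{x, y, z} \<in> flag_complex V A B \<longleftrightarrow> {x, y, z} \<subseteq> V \<and>
    (x \<in> A \<and> y \<in> A \<and> z \<notin> A \<or> x \<in> A \<and> y \<notin> A \<and> z \<in> A \<or> x \<notin> A \<and> y \<in> A \<and> z \<in> A \<or>
     x \<in> B \<and> y \<in> B \<and> z \<notin> B \<or> x \<in> B \<and> y \<notin> B \<and> z \<in> B \<or> x \<notin> B \<and> y \<in> B \<and> z \<in> B)"
  using assms by (auto simp: flag_complex_def Int_insert_left split: if_splits)

text \<open>Subsets of \<open>V\<close> with at most two elements lie in every flag complex on
  \<open>V\<close>, so only triples have to be compared.\<close>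

lemma flag_complex_subsetI:
  assumes "\<And>x y z. \<lbrakk>x \<noteq> y; x \<noteq> z; y \<noteq> z; {x, y, z} \<in> flag_complex V A' B'\<rbrakk>
    \<Longrightarrow> {x, y, z} \<in> flag_complex V A B"
  shows "flag_complex V A' B' \<subseteq> flag_complex V A B"
proof
  fix X assume X: "X \<in> flag_complex V A' B'"
  show "X \<in> flag_complex V A B"
  proof (cases "card X \<le> 2")
    case True
    then show ?thesis using X by (simp add: flag_complex_def)
  next
    case False
    then have "card X = 3" using X by (auto simp: flag_complex_def)
    then obtain x y z where "X = {x, y, z}" "x \<noteq> y" "x \<noteq> z" "y \<noteq> z"
      by (auto simp: card_3_iff)
    then show ?thesis using X assms by blast
  qed
qed

text \<open>A triple meeting \<open>A\<close> in two points meets \<open>B\<close> in two or three,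
  and in the latter case it equals \<open>B\<close>. So the complex is the same for every
  two-element subset \<open>A\<close> of \<open>B\<close>.\<close>

lemma flag_complex_card_3:
  assumes "A \<subseteq> B" "card A = 2" "card B = 3"
  shows "flag_complex V A B =
    {X. X \<subseteq> V \<and> (card X \<le> 2 \<or> card X = 3 \<and> (X = B \<or> card (X \<inter> B) = 2))}"
proof -
  have fin: "finite B" using assms(3) card.infinite by fastforce
  have "card (X \<inter> A) = 2 \<or> card (X \<inter> B) = 2 \<longleftrightarrow> X = B \<or> card (X \<inter> B) = 2"
    if X: "card X = 3" for X
  proof -
    have finX: "finite X" using X card.infinite by fastforce
    have "X = B" if *: "card (X \<inter> A) = 2" "card (X \<inter> B) \<noteq> 2"
    proof -
      have "card (X \<inter> A) \<le> card (X \<inter> B)" "card (X \<inter> B) \<le> card B"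
        using assms(1) fin by (intro card_mono; blast)+
      then have "card (X \<inter> B) = 3" using * assms by linarith
      then have "X \<inter> B = X" "X \<inter> B = B"
        using X assms(3) fin finX by (metis Int_lower1 Int_lower2 card_subset_eq)+
      then show ?thesis by simp
    qed
    moreover have "card (X \<inter> A) = 2" if "X = B"
      using that assms by (simp add: Int_absorb1)
    ultimately show ?thesis by blast
  qed
  then show ?thesis by (auto simp: flag_complex_def)
qed

lemma flag_complex_restrict:
  "flag_complex V A B \<inter> Pow (V - {p}) = flag_complex (V - {p}) (A - {p}) (B - {p})"
proof -
  have "X \<inter> (C - {p}) = X \<inter> C" if "X \<subseteq> V - {p}" for X C
    using that by blast
  then show ?thesis
    by (auto simp: flag_complex_def)
qed

lemma flag_card:
  assumes "flag V A B"
  shows "card V = card A + card (B - A) + card (V - B)"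
    "finite A" "finite B" "0 < card (B - A)" "0 < card (V - B)" "3 \<le> card B"
proof -
  have fin: "finite V" and sub: "A \<subset> B" "B \<subset> V" and "2 \<le> card A"
    using assms by (auto simp: flag_def)
  show *: "finite A" "finite B"
    using fin sub by (meson finite_subset psubset_imp_subset)+
  show "card V = card A + card (B - A) + card (V - B)"
    using fin sub * by (simp add: card_Diff_subset card_mono psubset_imp_subset)
  show "0 < card (B - A)" "0 < card (V - B)"
    using fin sub * by (auto simp: card_gt_0_iff)
  show "3 \<le> card B"
    using psubset_card_mono[OF *(2) sub(1)] \<open>2 \<le> card A\<close> by simp
qed

section \<open>Reduction to minimal flags\<close>

text \<open>If \<open>X\<close> has at most one element, \<open>X \<union> {p}\<close> is in
  \<open>H\<close> anyway. Only pairs \<open>X \<subseteq> A\<close> impose a condition, and their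
  extensions by a point outside \<open>A\<close> are exactly the triples meeting \<open>A\<close> in
  two points.\<close>

lemma TH_2_iff:
  assumes "subsets_le 2 V \<subseteq> H" "finite V"
  shows "A \<in> TH 2 (V, H) \<longleftrightarrow> A \<subseteq> V \<and> (\<forall>X. X \<subseteq> V \<and> card X = 3 \<and> card (X \<inter> A) = 2 \<longrightarrow> X \<in> H)"
    (is "?L \<longleftrightarrow> ?R")
proof
  assume L: ?L
  have "X \<in> H" if X: "X \<subseteq> V" "card X = 3" "card (X \<inter> A) = 2" for X
  proof -
    have "finite X" using X(2) by (metis card.infinite zero_neq_numeral)
    then have "card (X - A) = 1" using X by (metis card_Diff_subset_Int finite_Int diff_Suc_Suc
          numeral_3_eq_3 numeral_2_eq_2 diff_zero One_nat_def)
    then obtain p where p: "X - A = {p}" by (auto simp: card_1_singleton_iff)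
    have "X \<inter> A \<in> H \<inter> subsets_le 2 V"
      using assms X by (auto simp: subsets_le_def)
    moreover have "p \<in> V - A" using p X by blast
    ultimately have "(X \<inter> A) \<union> {p} \<in> H"
      using L by (auto simp: TH_def)
    moreover have "(X \<inter> A) \<union> {p} = X" using p by blast
    ultimately show ?thesis by simp
  qed
  then show ?R using L by (auto simp: TH_def)
next
  assume R: ?R
  have "X \<union> {p} \<in> H" if X: "X \<in> H \<inter> subsets_le 2 V" "X \<subseteq> A" "p \<in> V - A" for X p
  proof -
    have f: "finite X" using X assms(2) by (meson R finite_subset)
    have p: "p \<notin> X" using X by blast
    show ?thesis
    proof (cases "card X = 2")
      case True
      have "(X \<union> {p}) \<inter> A = X" using X by blast
      then show ?thesis using R True X f p
        by (auto simp: subsets_le_def)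
    next
      case False
      then have "card (X \<union> {p}) \<le> 2" using X f p by (auto simp: subsets_le_def)
      then have "X \<union> {p} \<in> subsets_le 2 V" using X by (auto simp: subsets_le_def)
      then show ?thesis using assms by blast
    qed
  qed
  then show ?L using R by (auto simp: TH_def)
qed

lemma J_subset_Pow:
  assumes "\<T> \<subseteq> Pow V"
  shows "J \<T> \<subseteq> Pow V"
proof
  fix X assume "X \<in> J \<T>"
  then obtain x :: "nat \<Rightarrow> 'a" and k T where "X = x ` {1..k}" "\<forall>i\<le>k. T i \<in> \<T>"
      "\<forall>i\<in>{1..k}. x i \<in> T i - T (i - 1)"
    unfolding J_def by blast
  then show "X \<in> Pow V" using assms by fastforce
qed

text \<open>A member of \<open>J\<close> with more than three elements needs a chain with four
  strict steps: the two below \<open>T 2\<close> give it two points, and \<open>T 4\<close> leaves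
  room above \<open>T 3\<close>. Conversely, \<open>{}\<close>, singletons and \<open>V\<close>
  always lie in \<open>TH\<close> and complete a flag to such a chain.\<close>

lemma goes_up_2_iff:
  assumes "subsets_le 2 V \<subseteq> H" "finite V"
  shows "goes_up 2 (V, H) \<longleftrightarrow>
    (\<exists>A B. flag V A B \<and> A \<in> TH 2 (V, H) \<and> B \<in> TH 2 (V, H))" (is "_ \<longleftrightarrow> ?R")
proof -
  let ?T = "TH 2 (V, H)"
  have TV: "?T \<subseteq> Pow V" by (auto simp: TH_def)
  \<comment> \<open>\<open>Max_gr_iff\<close> needs a finite nonempty set; the chain consisting of
    \<open>V\<close> alone, with \<open>k = 0\<close>, supplies
    \<open>{} \<in> J ?T\<close>.\<close>
  have "finite (J ?T)"
    using J_subset_Pow[OF TV] assms(2) by (meson finite_Pow_iff finite_subset)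
  moreover have "V \<in> ?T" by (auto simp: TH_def)
  then have "{} \<in> J ?T"
    unfolding J_def by (intro CollectI exI[of _ undefined] exI[of _ 0]) auto
  ultimately have "3 < Max (card ` J ?T) \<longleftrightarrow> (\<exists>X\<in>J ?T. 3 < card X)"
    by (subst Max_gr_iff) auto
  moreover have "goes_up 2 (V, H) \<longleftrightarrow> 3 < Max (card ` J ?T)"
    by (auto simp: goes_up_def sc_dim_def)
  ultimately have "goes_up 2 (V, H) \<longleftrightarrow> (\<exists>X\<in>J ?T. 3 < card X)"
    by simp
  also have "\<dots> \<longleftrightarrow> ?R"
  proof
    assume "\<exists>X\<in>J ?T. 3 < card X"
    then obtain x :: "nat \<Rightarrow> 'a" and k T where k: "3 < card (x ` {1..k})" and T: "\<forall>i\<le>k. T i \<in> ?T"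
        "\<forall>i\<in>{1..k}. T (i - 1) \<subset> T i"
      unfolding J_def by blast
    have "4 \<le> k" using k card_image_le[of "{1..k}" x] by simp
    then have ch: "T 0 \<subset> T 1" "T 1 \<subset> T 2" "T 2 \<subset> T 3" "T 3 \<subset> T 4"
      using T(2)[rule_format, of 1] T(2)[rule_format, of 2]
        T(2)[rule_format, of 3] T(2)[rule_format, of 4] by simp_all
    have in_T: "T 2 \<in> ?T" "T 3 \<in> ?T" "T 4 \<in> ?T" using T(1) \<open>4 \<le> k\<close> by auto
    then have "T 2 \<subseteq> V" "T 4 \<subseteq> V" using TV by auto
    then have "finite (T 2)" using assms(2) finite_subset by blast
    then have "card (T 0) < card (T 1)" "card (T 1) < card (T 2)"
      using ch by (meson finite_subset psubset_card_mono psubset_imp_subset)+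
    then have "flag V (T 2) (T 3)"
      using ch \<open>T 4 \<subseteq> V\<close> assms(2) by (auto simp: flag_def)
    then show ?R using in_T by blast
  next
    assume ?R
    then obtain A B where AB: "flag V A B" "A \<in> ?T" "B \<in> ?T" by blast
    then have sub: "A \<subset> B" "B \<subset> V" and "2 \<le> card A" by (auto simp: flag_def)
    then obtain a a' where a: "a \<in> A" "a' \<in> A" "a \<noteq> a'" by (metis card_ge_2_obtain)
    obtain b c where bc: "b \<in> B - A" "c \<in> V - B" using sub by blast
    have "{} \<in> ?T" "{a} \<in> ?T"
      using a sub assms by (auto simp: TH_2_iff Int_insert_right)
    \<comment> \<open>The chain is
      \<open>{} \<subset> {a} \<subset> A \<subset> B \<subset> V\<close>, with \<open>a\<close>,
      \<open>a'\<close>, \<open>b\<close>, \<open>c\<close> as the points gained at its four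
      steps.\<close>
    define T where "T = (\<lambda>i::nat. if i = 0 then {} else if i = 1 then {a} else if i = 2 then A
       else if i = 3 then B else V)"
    define x where "x = (\<lambda>i::nat. if i = 1 then a else if i = 2 then a' else if i = 3 then b else c)"
    have I: "{1..4::nat} = {1, 2, 3, 4}" by auto
    have "x ` {1..4} \<in> J ?T"
      unfolding J_def
    proof (intro CollectI exI[of _ x] exI[of _ 4] exI[of _ T] conjI)
      show "\<forall>i\<le>4. T i \<in> ?T"
        using \<open>{} \<in> ?T\<close> \<open>{a} \<in> ?T\<close> AB \<open>V \<in> ?T\<close> by (auto simp: T_def)
      show "\<forall>i\<in>{1..4}. T (i - 1) \<subset> T i \<and> x i \<in> T i - T (i - 1)"
        using a bc sub unfolding I by (auto simp: T_def x_def)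
    qed simp
    moreover have "card (x ` {1..4}) = 4"
      using a bc sub unfolding I by (auto simp: x_def card_insert_if)
    ultimately show "\<exists>X\<in>J ?T. 3 < card X" by force
  qed
  finally show ?thesis .
qed

text \<open>By \<open>TH_2_iff\<close>, having \<open>A\<close> and \<open>B\<close> in
  \<open>TH\<close> means that \<open>H\<close> contains precisely the triples required by the flag
  complex, which is thus the least such \<open>H\<close>.\<close>

lemma flag_complex_subset_iff:
  assumes "subsets_le 2 V \<subseteq> H" "flag V A B"
  shows "flag_complex V A B \<subseteq> H \<longleftrightarrow> A \<in> TH 2 (V, H) \<and> B \<in> TH 2 (V, H)"
proof -
  have "finite V" "A \<subseteq> V" "B \<subseteq> V" using assms by (auto simp: flag_def)
  then show ?thesis
    using assms(1) by (auto simp: TH_2_iff flag_complex_def subsets_le_def)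
qed

section \<open>Flag complexes as the minimal complexes that go up\<close>

lemma Pav_2I:
  assumes "finite V" "subsets_le 2 V \<subset> H" "\<And>X. X \<in> H \<Longrightarrow> X \<subseteq> V \<and> card X \<le> 3"
  shows "(V, H) \<in> Pav 2"
proof -
  obtain X where X: "X \<in> H" "X \<notin> subsets_le 2 V" using assms by blast
  then have card_X: "card X = 3" using assms(3)[of X] by (auto simp: subsets_le_def)
  have "H \<subseteq> Pow V" using assms(3) by blast
  then have "finite H" using assms(1) by (meson finite_Pow_iff finite_subset)
  then have "Max (card ` H) = 3"
    using X(1) card_X assms(3) by (intro Max_eqI) auto
  \<comment> \<open>Closure under subsets is automatic: a proper subset of a set with at most three
    elements has at most two.\<close>
  moreover have "Z \<in> H" if Y: "Y \<in> H" "Z \<subseteq> Y" for Y Z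
  proof (cases "Z = Y")
    case False
    have "finite Y" using assms Y finite_subset by blast
    then have "card Z < card Y" using False Y psubset_card_mono by blast
    then have "Z \<in> subsets_le 2 V" using assms(3)[OF Y(1)] Y by (auto simp: subsets_le_def)
    then show ?thesis using assms(2) by blast
  qed (use Y in simp)
  moreover note \<open>H \<subseteq> Pow V\<close>
  moreover have "V \<noteq> {}" using card_X assms(3)[OF X(1)] by auto
  moreover have "{v} \<in> H" if "v \<in> V" for v
    using that assms(2) by (auto simp: subsets_le_def)
  ultimately show ?thesis
    using assms(1) psubset_imp_subset[OF assms(2)]
    by (simp add: Pav_def simplicial_complex_def sc_dim_def)
qed

lemma Pav_2D:
  assumes "(V, H) \<in> Pav 2"
  shows "finite V" "subsets_le 2 V \<subseteq> H" "X \<in> H \<Longrightarrow> X \<subseteq> V \<and> card X \<le> 3"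
proof -
  show "finite V" "subsets_le 2 V \<subseteq> H"
    using assms by (auto simp: Pav_def simplicial_complex_def)
  have "H \<subseteq> Pow V" "Max (card ` H) = 3"
    using assms by (auto simp: Pav_def simplicial_complex_def sc_dim_def)
  moreover have "finite H"
    using \<open>finite V\<close> \<open>H \<subseteq> Pow V\<close> by (meson finite_Pow_iff finite_subset)
  ultimately show "X \<subseteq> V \<and> card X \<le> 3" if "X \<in> H"
    using that by (metis Max_ge PowD finite_imageI imageI subsetD)
qed

text \<open>Two points of \<open>A\<close> and one outside \<open>B\<close> form a triple of the
  complex. Strictness gives dimension 2 and lets flag complexes serve as \<open>H'\<close> in the
  definition of \<open>mGU\<close>.\<close>

lemma subsets_le_psubset_flag_complex:
  assumes "flag V A B"
  shows "subsets_le 2 V \<subset> flag_complex V A B"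
proof -
  have AB: "A \<subseteq> B" "B \<subseteq> V" "2 \<le> card A" using assms by (auto simp: flag_def)
  then obtain x y where xy: "x \<in> A" "y \<in> A" "x \<noteq> y" by (metis card_ge_2_obtain)
  obtain z where "z \<in> V" "z \<notin> B" using assms by (auto simp: flag_def)
  then have "x \<noteq> z" "y \<noteq> z" using xy AB by auto
  then have "{x, y, z} \<in> flag_complex V A B" "card {x, y, z} = 3"
    using xy AB \<open>z \<in> V\<close> \<open>z \<notin> B\<close> by (simp_all add: triple_in_flag_complex subset_iff)
  then have "{x, y, z} \<in> flag_complex V A B - subsets_le 2 V"
    by (auto simp: subsets_le_def)
  then show ?thesis by (auto simp: flag_complex_def subsets_le_def)
qed

lemma flag_complex_GU:
  assumes "flag V A B"
  shows "(V, flag_complex V A B) \<in> GU 2"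
proof -
  note sub = subsets_le_psubset_flag_complex[OF assms]
  have fin: "finite V" using assms by (simp add: flag_def)
  have "(V, flag_complex V A B) \<in> Pav 2"
    by (rule Pav_2I[OF fin sub]) (auto simp: flag_complex_def)
  \<comment> \<open>The inclusion of the complex in itself puts \<open>A\<close> and
    \<open>B\<close> into its \<open>TH\<close>.\<close>
  moreover have "goes_up 2 (V, flag_complex V A B)"
    using flag_complex_subset_iff[OF psubset_imp_subset[OF sub] assms] assms
    by (auto simp: goes_up_2_iff[OF psubset_imp_subset[OF sub] fin])
  ultimately show ?thesis by (simp add: GU_def)
qed

lemma GU_2_contains_flag_complex:
  assumes "(V, H) \<in> GU 2"
  obtains A B where "flag V A B" "flag_complex V A B \<subseteq> H"
proof -
  have "(V, H) \<in> Pav 2" "goes_up 2 (V, H)" using assms by (auto simp: GU_def)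
  then show ?thesis
    using that goes_up_2_iff flag_complex_subset_iff Pav_2D(1,2) by metis
qed

text \<open>Flag complexes go up, and every complex that goes up contains one, so both notions of
  minimality agree.\<close>

lemma mGU_2_iff: "(V, H) \<in> mGU 2 \<longleftrightarrow> (\<exists>A B. minimal_flag V A B \<and> H = flag_complex V A B)"
proof
  assume H: "(V, H) \<in> mGU 2"
  then have "(V, H) \<in> GU 2" by (auto simp: mGU_def)
  have eq: "flag_complex V A B = H" if "flag V A B" "flag_complex V A B \<subseteq> H" for A B
  proof (rule ccontr)
    assume "flag_complex V A B \<noteq> H"
    then have "(V, flag_complex V A B) \<in> NGU 2"
      using H that subsets_le_psubset_flag_complex[OF that(1)] by (auto simp: mGU_def)
    then show False using flag_complex_GU[OF that(1)] by (auto simp: GU_def NGU_def)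
  qed
  obtain A B where "flag V A B" "flag_complex V A B \<subseteq> H"
    using GU_2_contains_flag_complex[OF \<open>(V, H) \<in> GU 2\<close>] by blast
  then show "\<exists>A B. minimal_flag V A B \<and> H = flag_complex V A B"
    using eq by (metis minimal_flag_def)
next
  assume "\<exists>A B. minimal_flag V A B \<and> H = flag_complex V A B"
  then obtain A B where AB: "minimal_flag V A B" and H: "H = flag_complex V A B" by blast
  then have fl: "flag V A B" by (simp add: minimal_flag_def)
  have "(V, H') \<in> NGU 2" if H': "subsets_le 2 V \<subset> H'" "H' \<subset> H" for H'
  proof -
    have "(V, H') \<in> Pav 2"
      using fl H' by (intro Pav_2I) (auto simp: flag_def H flag_complex_def)
    moreover have "(V, H') \<notin> GU 2"
    proof
      assume "(V, H') \<in> GU 2"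
      then obtain A' B' where "flag V A' B'" "flag_complex V A' B' \<subseteq> H'"
        by (rule GU_2_contains_flag_complex)
      moreover from this have "flag_complex V A' B' = flag_complex V A B"
        using AB H' H by (simp add: minimal_flag_def)
      ultimately show False using H' H by blast
    qed
    ultimately show ?thesis by (auto simp: GU_def NGU_def)
  qed
  then show "(V, H) \<in> mGU 2"
    using flag_complex_GU[OF fl] by (auto simp: mGU_def H)
qed

section \<open>Classification of minimal flags\<close>

text \<open>For a flag \<open>A'\<close>, \<open>B'\<close> with smaller or equal complex,
  \<open>B' = B\<close> is forced first. Then either \<open>A' = A\<close>, or \<open>B\<close> has
  three points and the choice of the pair inside it does not affect the complex.\<close>

lemma minimal_flag_sufficient:
  assumes fl: "flag V A B" and C: "2 \<le> card (V - B)" and AB: "2 \<le> card (B - A) \<or> card A = 2"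
  shows "minimal_flag V A B"
proof -
  have "flag_complex V A' B' = flag_complex V A B"
    if fl': "flag V A' B'" and sub: "flag_complex V A' B' \<subseteq> flag_complex V A B" for A' B'
  proof -
    have AV: "A \<subset> B" "B \<subset> V" and AV': "A' \<subset> B'" "B' \<subset> V" and "2 \<le> card A'"
      using fl fl' by (auto simp: flag_def)
    have transfer: "{x, y, z} \<in> flag_complex V A B"
      if "{x, y, z} \<in> flag_complex V A' B'" for x y z
      using that sub by blast
    obtain a1 a2 where a: "a1 \<in> A'" "a2 \<in> A'" "a1 \<noteq> a2"
      using \<open>2 \<le> card A'\<close> card_ge_2_obtain by metis
    obtain b where b: "b \<in> B'" "b \<notin> A'" using AV' by blast
    obtain c where c: "c \<in> V" "c \<notin> B'" using AV' by blast
    \<comment> \<open>A triple through two points \<open>c1\<close>, \<open>c2\<close> outside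
      \<open>B\<close> has at most one point in \<open>B\<close>, so it is not in the larger
      complex; the third point is chosen so that it is in the smaller one.\<close>
    have "B' \<subseteq> B"
    proof (rule ccontr)
      assume "\<not> B' \<subseteq> B"
      then obtain c1 where c1: "c1 \<in> B'" "c1 \<notin> B" by blast
      obtain c2 where c2: "c2 \<in> V - B" "c2 \<noteq> c1" using C card_ge_2_obtain by metis
      obtain z where z: "z \<in> B'" "z \<noteq> c1" using a AV' by blast
      show False
      proof (cases "c2 \<in> B'")
        case True
        then have "{c1, c2, c} \<in> flag_complex V A' B'"
          using c c1 c2 AV' by (subst triple_in_flag_complex) auto
        from transfer[OF this] show False
          using True c c1 c2 AV by (subst (asm) triple_in_flag_complex) auto
      next
        case False
        then have "{c1, c2, z} \<in> flag_complex V A' B'"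
          using z c1 c2 AV' by (subst triple_in_flag_complex) auto
        from transfer[OF this] show False
          using False z c1 c2 AV by (subst (asm) triple_in_flag_complex) auto
      qed
    qed
    moreover have "B \<subseteq> B'"
    proof (rule ccontr)
      assume "\<not> B \<subseteq> B'"
      then obtain d where d: "d \<in> B" "d \<notin> B'" by blast
      \<comment> \<open>The triple \<open>{e, x, y}\<close> meets \<open>B'\<close> in two points
        but lies inside \<open>B\<close>, so it must meet \<open>A\<close> in exactly two.\<close>
      have two: "if e \<in> A then (x \<in> A) \<noteq> (y \<in> A) else x \<in> A \<and> y \<in> A"
        if "e \<in> B" "e \<notin> B'" "x \<in> B'" "y \<in> B'" "x \<noteq> y" for e x y
      proof -
        have "{e, x, y} \<in> flag_complex V A' B'"
          using that AV AV' by (subst triple_in_flag_complex) auto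
        from transfer[OF this] show ?thesis
          using that \<open>B' \<subseteq> B\<close> by (subst (asm) triple_in_flag_complex) auto
      qed
      \<comment> \<open>If \<open>e\<close> were in \<open>A\<close>, each pair among the three
        points \<open>a1\<close>, \<open>a2\<close>, \<open>b\<close> would have exactly one member
        in \<open>A\<close>, which is impossible.\<close>
      have notA: "e \<notin> A" if "e \<in> B" "e \<notin> B'" for e
        using two[OF that, of a1 a2] two[OF that, of a1 b] two[OF that, of a2 b] a b AV'
        by (metis psubsetD)
      then have "B' \<subseteq> A" using two[OF d] d a AV'
        by (metis (no_types, lifting) psubsetD subsetI)
      \<comment> \<open>This triple meets \<open>A'\<close> in two points but would lie wholly
        inside \<open>A\<close> and \<open>B\<close>.\<close>
      have "{a1, a2, b} \<in> flag_complex V A' B'"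
        using a b AV' by (subst triple_in_flag_complex) auto
      from transfer[OF this] show False
        using a b AV' AV \<open>B' \<subseteq> A\<close> by (subst (asm) triple_in_flag_complex) auto
    qed
    ultimately have B: "B' = B" by blast
    \<comment> \<open>Triples inside \<open>B = B'\<close> can enter either complex only through
      \<open>A\<close> or \<open>A'\<close>.\<close>
    have two: "(x \<in> A \<and> y \<in> A \<and> z \<notin> A) \<or> (x \<in> A \<and> y \<notin> A \<and> z \<in> A) \<or> (x \<notin> A \<and> y \<in> A \<and> z \<in> A)"
      if "x \<in> A'" "y \<in> A'" "x \<noteq> y" "z \<in> B" "z \<notin> A'" for x y z
    proof -
      have "{x, y, z} \<in> flag_complex V A' B'"
        using that AV' B by (subst triple_in_flag_complex) auto
      from transfer[OF this] show ?thesis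
        using that AV' B by (subst (asm) triple_in_flag_complex) auto
    qed
    show ?thesis
    proof (cases "A \<subseteq> A'")
      case True
      then have "A' \<subseteq> A" using two[of _ _ b] a b B by (metis subsetD subsetI)
      then show ?thesis using True B by auto
    next
      case False
      then obtain z where z: "z \<in> A" "z \<notin> A'" by blast
      have "z \<in> B" using z AV by blast
      have "\<exists>x y. x \<in> A' \<and> y \<in> A' \<and> x \<in> A \<and> y \<notin> A"
        using two[OF a \<open>z \<in> B\<close> z(2)] a z by blast
      then obtain x y where xy: "x \<in> A'" "y \<in> A'" "x \<in> A" "y \<notin> A" by blast
      then have "x \<noteq> y" by blast
      \<comment> \<open>For a third point \<open>w\<close> of \<open>A'\<close>, the triple
        \<open>{x, w, z}\<close> forces \<open>w \<notin> A\<close>, while \<open>{y, w, z}\<close>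
        forces \<open>w \<in> A\<close>.\<close>
      have A': "A' = {x, y}"
        using two[of x _ z] two[of y _ z] \<open>z \<in> B\<close> z xy by blast
      have "w \<in> A" if "w \<in> B" "w \<notin> A'" for w
        using two[of x y w] that xy by blast
      then have BA: "B - A = {y}" using xy A' AV' B by auto
      then have "card A = 2" using AB by simp
      moreover have "x \<noteq> z" using xy z by blast
      ultimately have A: "A = {x, z}"
        using xy(3) z(1) by (metis card_2_iff insertE singletonD insert_commute)
      have "y \<noteq> z" using xy z by blast
      have "B = {x, y, z}" using A BA AV by blast
      then show ?thesis
        unfolding B A A' using \<open>x \<noteq> y\<close> \<open>x \<noteq> z\<close> \<open>y \<noteq> z\<close> by (simp add: flag_complex_card_3)
    qed
  qed
  then show ?thesis using fl by (auto simp: minimal_flag_def)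
qed

text \<open>Here \<open>A\<close> has two points and \<open>B\<close> three, and every triple is
  \<open>B\<close> or meets it in two points. All flags thus share one complex, that of all subsets
  with at most three elements.\<close>

lemma minimal_flag_card_4:
  assumes "flag V A B" "card V = 4"
  shows "minimal_flag V A B"
proof -
  have "flag_complex V A B = {X. X \<subseteq> V \<and> card X \<le> 3}" if fl: "flag V A B" for A B
  proof -
    have "2 \<le> card A" "A \<subset> B" "B \<subset> V" using fl by (auto simp: flag_def)
    then have card: "card A = 2" "card B = 3" "card (V - B) = 1"
      using flag_card[OF fl] assms(2) by (simp_all add: card_Diff_subset psubset_imp_subset)
    have "card (X \<inter> B) = 2" if X: "X \<subseteq> V" "card X = 3" "X \<noteq> B" for X
    proof -
      have fin: "finite X" using X card.infinite by fastforce
      obtain c where c: "V - B = {c}" using card by (auto simp: card_1_singleton_iff)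
      have "\<not> X \<subseteq> B" using X card flag_card(3)[OF fl] by (metis card_subset_eq)
      moreover have "v \<in> B \<longleftrightarrow> v \<noteq> c" if "v \<in> V" for v using that c by blast
      ultimately have "X \<inter> B = X - {c}" "c \<in> X" using X(1) by blast+
      then show ?thesis using X fin by simp
    qed
    moreover have "n \<le> 3 \<longleftrightarrow> n \<le> 2 \<or> n = 3" for n :: nat by linarith
    ultimately show ?thesis
      using card \<open>A \<subset> B\<close> by (auto simp: flag_complex_card_3)
  qed
  then show ?thesis using assms by (auto simp: minimal_flag_def)
qed

text \<open>If one of the conditions fails, another flag has a strictly smaller complex.\<close>

lemma minimal_flag_necessary:
  assumes min: "minimal_flag V A B" and V: "4 < card V"
  shows "2 \<le> card (V - B)" "2 \<le> card (B - A) \<or> card A = 2"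
proof -
  have fl: "flag V A B" using min by (simp add: minimal_flag_def)
  then have AV: "A \<subset> B" "B \<subset> V" "2 \<le> card A" "finite V" by (auto simp: flag_def)
  note card = flag_card[OF fl]
  show *: "2 \<le> card (B - A) \<or> card A = 2"
  proof (rule ccontr)
    assume "\<not> ?thesis"
    then have "card (B - A) = 1" "3 \<le> card A" using card AV by auto
    then obtain b a1 a2 a3 where b: "B - A = {b}"
      and a: "a1 \<in> A" "a2 \<in> A" "a3 \<in> A" "a1 \<noteq> a2" "a1 \<noteq> a3" "a2 \<noteq> a3"
      by (metis card_1_singletonE card_ge_3_obtain)
    have B: "B = insert b A" "b \<notin> A" using b AV by auto
    have "a1 \<noteq> b" using a B(2) by blast
    moreover have "{a1, b} \<subset> B"
    proof
      show "{a1, b} \<subseteq> B" using a B(1) by simp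
      show "{a1, b} \<noteq> B" using a B by (metis insertCI insertE singletonD)
    qed
    \<comment> \<open>A triple \<open>{a1, b, z}\<close> meets \<open>A\<close> in two points if
      \<open>z \<in> A\<close>, and \<open>B\<close> in two points if \<open>z \<notin> B\<close>;
      the triple \<open>{a2, a3, b}\<close> is lost.\<close>
    ultimately have "flag V {a1, b} B"
      using AV by (simp add: flag_def)
    moreover have "flag_complex V {a1, b} B \<subseteq> flag_complex V A B"
    proof (rule flag_complex_subsetI)
      fix x y z
      assume ne: "x \<noteq> y" "x \<noteq> z" "y \<noteq> z" and "{x, y, z} \<in> flag_complex V {a1, b} B"
      then show "{x, y, z} \<in> flag_complex V A B"
        unfolding triple_in_flag_complex[OF ne] B(1) using a(1) B(2) by auto
    qed
    ultimately have "flag_complex V {a1, b} B = flag_complex V A B"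
      using min by (simp add: minimal_flag_def)
    moreover have "{a2, a3, b} \<in> flag_complex V A B"
      using a B AV by (subst triple_in_flag_complex) auto
    moreover have "{a2, a3, b} \<notin> flag_complex V {a1, b} B"
      using a B AV by (subst triple_in_flag_complex) auto
    ultimately show False by simp
  qed
  show "2 \<le> card (V - B)"
  proof (rule ccontr)
    assume "\<not> ?thesis"
    \<comment> \<open>With a single point in \<open>B - A\<close>, the first condition would give
      \<open>card A = 2\<close> and only four vertices.\<close>
    then have "card (V - B) = 1" "2 \<le> card (B - A)" using card * V by auto
    then obtain c b1 b2 where c: "V - B = {c}" and b: "b1 \<in> B - A" "b2 \<in> B - A" "b1 \<noteq> b2"
      by (metis card_1_singletonE card_ge_2_obtain)
    have V': "V = insert c B" "c \<notin> B" using c AV by auto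
    \<comment> \<open>A triple \<open>{a, c, z}\<close> with \<open>a \<in> A\<close> and
      \<open>z \<in> B - A\<close> meets \<open>B\<close> in two points, so nothing new arises;
      \<open>{b1, b2, c}\<close> is lost.\<close>
    have "flag V A (insert c A)"
      using AV b V' by (auto simp: flag_def)
    moreover have "flag_complex V A (insert c A) \<subseteq> flag_complex V A B"
    proof (rule flag_complex_subsetI)
      fix x y z
      assume ne: "x \<noteq> y" "x \<noteq> z" "y \<noteq> z" and "{x, y, z} \<in> flag_complex V A (insert c A)"
      then show "{x, y, z} \<in> flag_complex V A B"
        unfolding triple_in_flag_complex[OF ne] V'(1)
        using psubset_imp_subset[OF AV(1)] V'(2) by auto
    qed
    ultimately have "flag_complex V A (insert c A) = flag_complex V A B"
      using min by (simp add: minimal_flag_def)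
    moreover have "{b1, b2, c} \<in> flag_complex V A B"
      using b V' AV by (subst triple_in_flag_complex) auto
    moreover have "{b1, b2, c} \<notin> flag_complex V A (insert c A)"
      using b V' AV by (subst triple_in_flag_complex) auto
    ultimately show False by simp
  qed
qed

section \<open>Deletion of a vertex\<close>

theorem theorem13p19:
  fixes V :: "'a set" and H :: "'a set set"
  assumes "(V, H) \<in> mGU 2"
    and "card V > 4"
  shows "\<exists>p\<in>V. sc_restrict (V, H) (V - {p}) \<in> mGU 2"
proof -
  obtain A B where min: "minimal_flag V A B" and H: "H = flag_complex V A B"
    using assms(1) mGU_2_iff by metis
  then have fl: "flag V A B" by (simp add: minimal_flag_def)
  then have AV: "A \<subset> B" "B \<subset> V" "2 \<le> card A" "finite V" by (auto simp: flag_def)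
  note card = flag_card[OF fl]
  note nec = minimal_flag_necessary[OF min assms(2)]
  have "\<exists>p\<in>V. minimal_flag (V - {p}) (A - {p}) (B - {p})"
  proof -
    \<comment> \<open>The cases name the block that loses \<open>p\<close>: (C) is
      \<open>V - B\<close>, (B) is \<open>B - A\<close>, (A) is \<open>A\<close>. Each block is used
      only when the conditions survive, or when four vertices remain.\<close>
    consider (C) "3 \<le> card (V - B) \<or> card (B - A) = 1"
      | (B) "card (V - B) = 2" "3 \<le> card (B - A) \<or> card (B - A) = 2 \<and> card A = 2"
      | (A) "card (V - B) = 2" "card (B - A) = 2" "3 \<le> card A"
      using nec card AV by linarith
    then show ?thesis
    proof cases
      case C
      obtain p where p: "p \<in> V" "p \<notin> B" using AV by blast
      then have *: "A - {p} = A" "B - {p} = B" "V - {p} - B = (V - B) - {p}" using AV by auto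
      have cV: "card (V - {p} - B) = card (V - B) - 1" using p * by simp
      obtain c where "c \<in> V - B" "c \<noteq> p" using nec(1) card_ge_2_obtain by metis
      then have fl': "flag (V - {p}) A B" using AV p by (auto simp: flag_def)
      have "minimal_flag (V - {p}) A B"
      proof (cases "3 \<le> card (V - B)")
        case True
        then show ?thesis using fl' cV nec(2) by (intro minimal_flag_sufficient) auto
      next
        case False
        \<comment> \<open>The blocks \<open>A\<close>, \<open>B - A\<close>, \<open>V - B\<close>
          have sizes 2, 1, 2, so the four-vertex case applies after deletion.\<close>
        then have "card (V - {p}) = 4" using C nec card p by simp
        then show ?thesis using fl' minimal_flag_card_4 by blast
      qed
      then show ?thesis using p * by (intro bexI[of _ p]) simp_all
    next
      case B
      then have "2 \<le> card (B - A)" by auto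
      then obtain p b where p: "p \<in> B - A" "b \<in> B - A" "b \<noteq> p" using card_ge_2_obtain by metis
      then have *: "A - {p} = A" "V - {p} - (B - {p}) = V - B" "B - {p} - A = (B - A) - {p}"
        using AV by auto
      have "card (B - {p} - A) = card (B - A) - 1" unfolding *(3) using p by simp
      moreover have "flag (V - {p}) A (B - {p})" using p AV by (auto simp: flag_def)
      moreover have "card (V - {p} - (B - {p})) = card (V - B)" unfolding *(2) ..
      ultimately have "minimal_flag (V - {p}) A (B - {p})"
        using B by (intro minimal_flag_sufficient) linarith+
      then show ?thesis using p *(1) AV(2) by (intro bexI[of _ p]) auto
    next
      case A
      then obtain p where p: "p \<in> A" by fastforce
      then have *: "V - {p} - (B - {p}) = V - B" "B - {p} - (A - {p}) = B - A"
        using AV by auto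
      \<comment> \<open>As \<open>A\<close> has at least three points, two survive; the other two
        blocks keep their size 2.\<close>
      have "flag (V - {p}) (A - {p}) (B - {p})" using p AV A by (auto simp: flag_def)
      then have "minimal_flag (V - {p}) (A - {p}) (B - {p})"
        by (rule minimal_flag_sufficient) (use A in \<open>simp_all only: *, simp\<close>)
      then show ?thesis using p AV by (intro bexI[of _ p]) auto
    qed
  qed
  then show ?thesis
    by (auto simp: H sc_restrict_def flag_complex_restrict mGU_2_iff)
qed

end
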